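(* Let $P\subset\mathbb{R}^2$ be a finite set of points. For all integers $n>0$, $$|\nu^n(P)|\le 2^n\left(|P|-5\right)+5 .$$
   Context: For a finite set $P\subset\mathbb{R}^2$ (the generating set) and $p\in P$, the Voronoi polygon of $p$ is $V(p)=\{x\in\mathbb{R}^2 : \|p-x\|\le\|p'-x\| \text{ for all } p'\in P\}$, and the Voronoi tessellation is $\Upsilon(P)=\{V(p) : p\in P\}$. A point is a Voronoi vertex of $\Upsilon(P)$ if it is the (one-point) intersection of three or more Voronoi polygons of $\Upsilon(P)$. The Voronoi iteration $\nu(P)$ is the (finite) set of all Voronoi vertices of $\Upsilon(P)$ (with $\nu(\emptyset)=\emptyset$), and $\nu^n(P)=\nu(\nu^{n-1}(P))$ for $n\ge2$, $\nu^1=\nu$. $|\cdot|$ denotes cardinality.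
   Formalization: The right-hand side is replaced by max(0, 2^n(|P|−5)+5), because the stated bound is negative, hence false, for some small P (e.g. P empty, n=1: 0 ≤ −5); where the bound is nonnegative, in particular for |P| ≥ 5, it is unchanged. *)

theory Defs
  imports "HOL-Analysis.Analysis"
begin

definition voronoi_polygon :: "(real ^ 2) set \<Rightarrow> real ^ 2 \<Rightarrow> (real ^ 2) set" where
  "voronoi_polygon P p = {x. \<forall>p'\<in>P. norm (p - x) \<le> norm (p' - x)}"

definition voronoi_tessellation :: "(real ^ 2) set \<Rightarrow> (real ^ 2) set set" where
  "voronoi_tessellation P = {voronoi_polygon P p |p. p \<in> P}"

text \<open>For finite \<open>P\<close> the tessellation is finite, so \<open>card\<close> counts the polygons of a
  subfamily correctly; distinct generating points have distinct polygons, since \<open>p\<close> is the only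
  point of \<open>P\<close> lying in its own polygon.\<close>

definition voronoi_vertex :: "(real ^ 2) set \<Rightarrow> real ^ 2 \<Rightarrow> bool" where
  "voronoi_vertex P x \<longleftrightarrow>
     (\<exists>\<V>. \<V> \<subseteq> voronoi_tessellation P \<and> card \<V> \<ge> 3 \<and> \<Inter>\<V> = {x})"

definition voronoi_iteration :: "(real ^ 2) set \<Rightarrow> (real ^ 2) set" where
  "voronoi_iteration P = {x. voronoi_vertex P x}"

end

theory Submission
  imports Defs
begin

text \<open>
  One iteration satisfies \<open>|\<nu>(P)| \<le> 2 |P| - 5\<close> as soon as there is a Voronoi vertex, and the
  recursion \<open>f \<mapsto> 2 f - 5\<close> has fixed point \<open>5\<close>, which gives the closed form. The bound for one
  iteration is usually derived from Euler's formula for planar graphs. Here it comes from a sweep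
  of the plane by parallel lines.

  Choose orthogonal directions \<open>u\<close> (sweep) and \<open>w\<close> such that \<open>w\<close> separates the points of \<open>P\<close>; then
  no Voronoi edge is parallel to \<open>w\<close>. A Voronoi vertex lies in the cells of three points
  \<open>a\<close>, \<open>b\<close>, \<open>c\<close>, ordered by \<open>w\<close>. The middle point \<open>b\<close> lies strictly on one side of the
  chord \<open>a c\<close>, and this forces the cell of \<open>b\<close> to begin, or to end, exactly at
  the vertex when the plane is swept in direction \<open>u\<close> (lemma \<open>voronoi_vertex_is_cell_tip\<close>).
  Every cell begins at most once and ends at most once, so there are at most \<open>2 |P|\<close> vertices.

  Five of these \<open>2 |P|\<close> events never happen. The cells of the \<open>w\<close>-highest and of the \<open>w\<close>-lowest
  point extend over the whole sweep and have neither a beginning nor an end (lemma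
  \<open>no_tip_of_strict_maximizer\<close>). Since \<open>P\<close> is not collinear, a third
  point of \<open>P\<close> lies on the boundary of the convex hull and has a cell containing a ray that is
  not parallel to \<open>w\<close>. This cell lacks a beginning or an end (lemmas
  \<open>third_hull_boundary_point\<close> and \<open>no_tip_along_ray\<close>).
\<close>

section \<open>Voronoi cells as intersections of half-planes\<close>

lemma norm_le_bisector_iff:
  fixes p q x :: "'a::real_inner"
  shows "norm (p - x) \<le> norm (q - x) \<longleftrightarrow> p \<bullet> p - q \<bullet> q \<le> 2 * (x \<bullet> (p - q))"
  unfolding norm_le by (simp add: inner_diff inner_commute algebra_simps)

lemma voronoi_polygon_iff:
  "x \<in> voronoi_polygon P p \<longleftrightarrow> (\<forall>q\<in>P. p \<bullet> p - q \<bullet> q \<le> 2 * (x \<bullet> (p - q)))"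
  by (simp add: voronoi_polygon_def norm_le_bisector_iff)

text \<open>Seen from a common point \<open>x\<close> of two cells, each cell lies on its own side of the bisector,
  which passes through \<open>x\<close>.\<close>

lemma voronoi_polygon_side:
  assumes "x \<in> voronoi_polygon P a" "x \<in> voronoi_polygon P b" "y \<in> voronoi_polygon P b"
    and "a \<in> P" "b \<in> P"
  shows "0 \<le> (y - x) \<bullet> (b - a)"
proof -
  have "a \<bullet> a - b \<bullet> b \<le> 2 * (x \<bullet> (a - b))" "b \<bullet> b - a \<bullet> a \<le> 2 * (y \<bullet> (b - a))"
    using assms by (auto simp: voronoi_polygon_iff)
  then show ?thesis by (simp add: inner_diff)
qed

lemma voronoi_vertex_three_cells:
  assumes "voronoi_vertex P x"
  obtains a b c where "a \<in> P" "b \<in> P" "c \<in> P" "a \<noteq> b" "a \<noteq> c" "b \<noteq> c"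
    "x \<in> voronoi_polygon P a" "x \<in> voronoi_polygon P b" "x \<in> voronoi_polygon P c"
proof -
  from assms obtain F where F: "F \<subseteq> voronoi_tessellation P" "card F \<ge> 3" "\<Inter>F = {x}"
    unfolding voronoi_vertex_def by auto
  obtain F' where "F' \<subseteq> F" "card F' = 3"
    using F(2) by (meson obtain_subset_with_card_n)
  then obtain A B C where ABC: "A \<in> F" "B \<in> F" "C \<in> F" "A \<noteq> B" "A \<noteq> C" "B \<noteq> C"
    by (auto simp: card_3_iff)
  have cell: "\<exists>p\<in>P. X = voronoi_polygon P p" if "X \<in> F" for X
    using F(1) that by (auto simp: voronoi_tessellation_def)
  obtain a b c where abc: "a \<in> P" "b \<in> P" "c \<in> P"
    and eq: "A = voronoi_polygon P a" "B = voronoi_polygon P b" "C = voronoi_polygon P c"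
    using cell[OF ABC(1)] cell[OF ABC(2)] cell[OF ABC(3)] by auto
  have "x \<in> A" "x \<in> B" "x \<in> C" using F(3) ABC by auto
  moreover have "a \<noteq> b" "a \<noteq> c" "b \<noteq> c" using ABC(4-6) eq by auto
  ultimately show thesis using abc unfolding eq by (intro that)
qed

section \<open>Tips of cells\<close>

text \<open>The point at which the cell of \<open>p\<close> is first met by lines orthogonal to \<open>e\<close> that move in
  direction \<open>e\<close>. The inequality is strict so that a cell has at most one tip in each direction.\<close>

definition cell_tip :: "(real ^ 2) set \<Rightarrow> real ^ 2 \<Rightarrow> real ^ 2 \<Rightarrow> real ^ 2 \<Rightarrow> bool" where
  "cell_tip P p e x \<longleftrightarrow>
     x \<in> voronoi_polygon P p \<and> (\<forall>y\<in>voronoi_polygon P p. y \<noteq> x \<longrightarrow> e \<bullet> x < e \<bullet> y)"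

lemma cell_tip_unique:
  assumes "cell_tip P p e x" "cell_tip P p e y"
  shows "x = y"
proof (rule ccontr)
  assume "x \<noteq> y"
  with assms have "e \<bullet> x < e \<bullet> y" "e \<bullet> y < e \<bullet> x" unfolding cell_tip_def by auto
  then show False by simp
qed

text \<open>Every ray in direction \<open>w\<close> finally stays in the cell of the strict \<open>w\<close>-maximizer. Hence a
  point of the cell can be moved backwards by \<open>e\<close> and then pushed back into the cell along \<open>w\<close>,
  which does not change its \<open>e\<close>-coordinate.\<close>

lemma no_tip_of_strict_maximizer:
  assumes fin: "finite P" and max: "\<And>q. q \<in> P \<Longrightarrow> q \<noteq> p \<Longrightarrow> w \<bullet> q < w \<bullet> p"
    and orth: "e \<bullet> w = 0" and "e \<noteq> 0"
  shows "\<not> cell_tip P p e x"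
proof
  assume tip: "cell_tip P p e x"
  \<comment> \<open>For \<open>q \<noteq> p\<close>, the half-plane of \<open>q\<close> contains \<open>x - e + s w\<close> from \<open>s = f q\<close> on.\<close>
  define f where "f q = (p \<bullet> p - q \<bullet> q - 2 * ((x - e) \<bullet> (p - q))) / (2 * (w \<bullet> (p - q)))" for q
  obtain s where s: "\<And>q. q \<in> P \<Longrightarrow> f q \<le> s"
    using bdd_above_finite[OF finite_imageI[OF fin, of f]] unfolding bdd_above_def by blast
  define y where "y = x - e + s *\<^sub>R w"
  have "p \<bullet> p - q \<bullet> q \<le> 2 * (y \<bullet> (p - q))" if q: "q \<in> P" for q
  proof (cases "q = p")
    case False
    then have "0 < 2 * (w \<bullet> (p - q))" using max[OF q] by (simp add: inner_diff)
    then have "p \<bullet> p - q \<bullet> q - 2 * ((x - e) \<bullet> (p - q)) \<le> s * (2 * (w \<bullet> (p - q)))"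
      using s[OF q] unfolding f_def by (simp only: pos_divide_le_eq)
    then show ?thesis unfolding y_def inner_add_left inner_scaleR_left by simp
  qed simp
  then have "y \<in> voronoi_polygon P p" by (simp add: voronoi_polygon_iff)
  moreover have "e \<bullet> y < e \<bullet> x"
    using orth \<open>e \<noteq> 0\<close> by (simp add: y_def inner_add_right inner_diff_right)
  ultimately show False using tip unfolding cell_tip_def by force
qed

text \<open>If \<open>r\<close> maximizes \<open>v\<close> over \<open>P\<close>, then \<open>r\<close> is the foot of the perpendicular from any point
  \<open>r + s v\<close> with \<open>s \<ge> 0\<close> to a line that has all of \<open>P\<close> on its other side. So the whole ray
  belongs to the cell of \<open>r\<close>, also when \<open>r\<close> is not the only maximizer.\<close>

lemma ray_in_voronoi_polygon:
  assumes "\<And>q. q \<in> P \<Longrightarrow> v \<bullet> q \<le> v \<bullet> r" and "0 \<le> s"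
  shows "r + s *\<^sub>R v \<in> voronoi_polygon P r"
  unfolding voronoi_polygon_iff
proof
  fix q assume "q \<in> P"
  then have "0 \<le> s * (v \<bullet> (r - q))" using assms by (simp add: inner_diff_right)
  moreover have "0 \<le> (r - q) \<bullet> (r - q)" by simp
  ultimately show "r \<bullet> r - q \<bullet> q \<le> 2 * ((r + s *\<^sub>R v) \<bullet> (r - q))"
    by (simp add: inner_diff inner_add inner_commute algebra_simps)
qed

lemma no_tip_along_ray:
  assumes max: "\<And>q. q \<in> P \<Longrightarrow> v \<bullet> q \<le> v \<bullet> r" and neg: "e \<bullet> v < 0"
  shows "\<not> cell_tip P r e x"
proof
  assume tip: "cell_tip P r e x"
  define s where "s = (\<bar>e \<bullet> x - e \<bullet> r\<bar> + 1) / - (e \<bullet> v)"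
  have "0 \<le> s" unfolding s_def using neg by (intro divide_nonneg_pos) auto
  then have mem: "r + s *\<^sub>R v \<in> voronoi_polygon P r"
    by (intro ray_in_voronoi_polygon max)
  have "s * (e \<bullet> v) = - (\<bar>e \<bullet> x - e \<bullet> r\<bar> + 1)"
    unfolding s_def using neg by (simp add: field_simps)
  then have "e \<bullet> (r + s *\<^sub>R v) < e \<bullet> x" by (simp add: inner_add_right)
  with tip mem show False unfolding cell_tip_def by force
qed

section \<open>Sweep frames\<close>

lemma finite_maximizer:
  fixes f :: "'a \<Rightarrow> 'b::linorder"
  assumes "finite S" "x \<in> S"
  obtains r where "r \<in> S" "\<And>y. y \<in> S \<Longrightarrow> f y \<le> f r"
proof -
  have "Max (f ` S) \<in> f ` S" using assms by (intro Max_in) auto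
  then obtain r where "r \<in> S" "Max (f ` S) = f r" by blast
  then show thesis using that assms(1) by (metis Max_ge finite_imageI imageI)
qed

lemma plane_orthogonal_parallel:
  fixes u w z :: "real ^ 2"
  assumes "w \<noteq> 0" "u \<noteq> 0" "w \<bullet> u = 0" "w \<bullet> z = 0"
  obtains k where "z = k *\<^sub>R u"
proof -
  have w: "w $ 1 \<noteq> 0 \<or> w $ 2 \<noteq> 0" and u: "u $ 1 \<noteq> 0 \<or> u $ 2 \<noteq> 0"
    using assms(1,2) by (auto simp: vec_eq_iff forall_2)
  have e: "w $ 1 * u $ 1 + w $ 2 * u $ 2 = 0" "w $ 1 * z $ 1 + w $ 2 * z $ 2 = 0"
    using assms(3,4) by (simp_all add: inner_vec_def sum_2)
  have "w $ 1 * (z $ 1 * u $ 2 - z $ 2 * u $ 1) =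
      (w $ 1 * z $ 1 + w $ 2 * z $ 2) * u $ 2 - (w $ 1 * u $ 1 + w $ 2 * u $ 2) * z $ 2"
    "w $ 2 * (z $ 1 * u $ 2 - z $ 2 * u $ 1) =
      (w $ 1 * u $ 1 + w $ 2 * u $ 2) * z $ 1 - (w $ 1 * z $ 1 + w $ 2 * z $ 2) * u $ 1"
    by (simp_all add: algebra_simps)
  then have cross: "z $ 1 * u $ 2 = z $ 2 * u $ 1" using w unfolding e by auto
  show thesis
  proof (cases "u $ 1 = 0")
    case True
    then show thesis using that[of "z $ 2 / u $ 2"] u cross
      by (simp add: vec_eq_iff forall_2)
  next
    case False
    then show thesis using that[of "z $ 1 / u $ 1"] cross
      by (simp add: vec_eq_iff forall_2 field_simps)
  qed
qed

locale sweep_frame =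
  fixes P :: "(real ^ 2) set" and u w :: "real ^ 2"
  assumes finite_points: "finite P"
    and u_nonzero: "u \<noteq> 0" and w_nonzero: "w \<noteq> 0" and orthogonal: "w \<bullet> u = 0"
    and separates: "inj_on (\<lambda>p. w \<bullet> p) P"

text \<open>For \<open>w = (t, 1)\<close> each pair of distinct points is separated by all but at most one \<open>t\<close>.\<close>

lemma sweep_frame_exists:
  assumes "finite P"
  obtains u w where "sweep_frame P u w"
proof -
  define bad where "bad = (\<lambda>(p, q). - (p $ 2 - q $ 2) / (p $ 1 - q $ 1)) ` (P \<times> P)"
  have "finite bad" using assms unfolding bad_def by simp
  then obtain t where t: "t \<notin> bad" by (metis ex_new_if_finite infinite_UNIV_char_0)
  define w :: "real ^ 2" where "w = vector [t, 1]"
  define u :: "real ^ 2" where "u = vector [1, - t]"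
  have "p = q" if pq: "p \<in> P" "q \<in> P" "w \<bullet> p = w \<bullet> q" for p q
  proof -
    have e: "t * (p $ 1 - q $ 1) = - (p $ 2 - q $ 2)"
      using pq(3) by (simp add: w_def inner_vec_def sum_2 algebra_simps)
    have "p $ 1 = q $ 1"
    proof (rule ccontr)
      assume "p $ 1 \<noteq> q $ 1"
      then have "t = - (p $ 2 - q $ 2) / (p $ 1 - q $ 1)" using e by (simp add: field_simps)
      then show False using t pq(1,2) unfolding bad_def by force
    qed
    with e show ?thesis by (simp add: vec_eq_iff forall_2)
  qed
  then have "sweep_frame P u w"
    using assms by unfold_locales
      (auto simp: u_def w_def inj_on_def vec_eq_iff forall_2 inner_vec_def sum_2)
  then show thesis by (rule that)
qed

context sweep_frame
begin

text \<open>The combination in the conclusion cancels the \<open>w\<close>-component, so it is a multiple \<open>k u\<close> that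
  measures the position of \<open>b\<close> relative to the chord \<open>a c\<close>. A line meets a circle in at most two
  points, hence \<open>k \<noteq> 0\<close>.\<close>

lemma voronoi_vertex_ordered_cells:
  assumes "voronoi_vertex P x"
  obtains a b c k where "a \<in> P" "b \<in> P" "c \<in> P" "w \<bullet> b < w \<bullet> a" "w \<bullet> c < w \<bullet> b"
    "x \<in> voronoi_polygon P a" "x \<in> voronoi_polygon P b" "x \<in> voronoi_polygon P c"
    "(w \<bullet> (b - c)) *\<^sub>R (b - a) + (w \<bullet> (a - b)) *\<^sub>R (b - c) = k *\<^sub>R u" "k \<noteq> 0"
proof -
  define good where "good a b c \<longleftrightarrow> a \<in> P \<and> b \<in> P \<and> c \<in> P \<and> w \<bullet> b < w \<bullet> a \<and> w \<bullet> c < w \<bullet> b \<and>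
    x \<in> voronoi_polygon P a \<and> x \<in> voronoi_polygon P b \<and> x \<in> voronoi_polygon P c" for a b c
  obtain a b c where good: "good a b c"
  proof -
    obtain a b c where abc: "a \<in> P" "b \<in> P" "c \<in> P" "a \<noteq> b" "a \<noteq> c" "b \<noteq> c"
      "x \<in> voronoi_polygon P a" "x \<in> voronoi_polygon P b" "x \<in> voronoi_polygon P c"
      by (rule voronoi_vertex_three_cells[OF assms])
    have "w \<bullet> a \<noteq> w \<bullet> b" "w \<bullet> a \<noteq> w \<bullet> c" "w \<bullet> b \<noteq> w \<bullet> c"
      using inj_onD[OF separates] abc(1-6) by blast+
    then have "good a b c \<or> good a c b \<or> good b a c \<or> good b c a \<or> good c a b \<or> good c b a"
      using abc by (simp add: good_def) linarith
    then show thesis using that by blast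
  qed
  then have abc: "a \<in> P" "b \<in> P" "c \<in> P" "w \<bullet> b < w \<bullet> a" "w \<bullet> c < w \<bullet> b"
    "x \<in> voronoi_polygon P a" "x \<in> voronoi_polygon P b" "x \<in> voronoi_polygon P c"
    unfolding good_def by auto
  define \<alpha> \<gamma> where "\<alpha> = w \<bullet> (a - b)" and "\<gamma> = w \<bullet> (b - c)"
  have pos: "\<alpha> > 0" "\<gamma> > 0" using abc by (auto simp: \<alpha>_def \<gamma>_def inner_diff_right)
  have "w \<bullet> (\<gamma> *\<^sub>R (b - a) + \<alpha> *\<^sub>R (b - c)) = 0"
    by (simp add: \<alpha>_def \<gamma>_def inner_add_right inner_diff_right algebra_simps)
  then obtain k where k: "\<gamma> *\<^sub>R (b - a) + \<alpha> *\<^sub>R (b - c) = k *\<^sub>R u"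
    using plane_orthogonal_parallel[OF w_nonzero u_nonzero orthogonal] by blast
  have "k \<noteq> 0"
  proof
    assume "k = 0"
    \<comment> \<open>Seen from \<open>x\<close>, the points \<open>a\<close>, \<open>b\<close>, \<open>c\<close> are \<open>B - D\<close>, \<open>B\<close>, \<open>B + m D\<close>, all of the same norm.\<close>
    define m where "m = \<gamma> / \<alpha>"
    have "m > 0" using pos by (simp add: m_def)
    have "c - b = (1 / \<alpha>) *\<^sub>R (\<alpha> *\<^sub>R (c - b))" using pos by simp
    also have "\<alpha> *\<^sub>R (c - b) = \<gamma> *\<^sub>R (b - a)"
      using k \<open>k = 0\<close> by (simp add: algebra_simps)
    finally have c: "c - b = m *\<^sub>R (b - a)" by (simp add: m_def)
    have na: "norm (a - x) = norm (b - x)" and nc: "norm (c - x) = norm (b - x)"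
      using abc unfolding voronoi_polygon_def by (auto intro!: antisym)
    define B D where "B = b - x" and "D = b - a"
    have ax: "a - x = B - D" and cx: "c - x = B + m *\<^sub>R D"
      using c by (auto simp: B_def D_def algebra_simps)
    have "(B - D) \<bullet> (B - D) = B \<bullet> B" using na ax unfolding norm_eq B_def by simp
    then have 1: "2 * (B \<bullet> D) = D \<bullet> D"
      by (simp add: inner_diff inner_commute algebra_simps)
    have "(B + m *\<^sub>R D) \<bullet> (B + m *\<^sub>R D) = B \<bullet> B" using nc cx unfolding norm_eq B_def by simp
    then have "m * (2 * (B \<bullet> D)) + m * (m * (D \<bullet> D)) = 0"
      by (simp add: inner_add inner_commute algebra_simps)
    then have "(m * (1 + m)) * (D \<bullet> D) = 0" unfolding 1 by (simp add: algebra_simps)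
    then have "D = 0" using \<open>m > 0\<close> by simp
    then show False using abc(4) by (simp add: D_def)
  qed
  then show thesis by (rule that[OF abc k[unfolded \<alpha>_def \<gamma>_def]])
qed

text \<open>In the terms of \<open>voronoi_vertex_ordered_cells\<close>: if \<open>b\<close> lies on the \<open>u\<close>-side of the chord
  \<open>a c\<close>, then a direction \<open>d\<close> from \<open>x\<close> into the cell of \<open>b\<close>, having nonnegative product with
  \<open>b - a\<close> and \<open>b - c\<close>, has nonnegative product with \<open>u\<close>. The product is zero only for \<open>d\<close>
  parallel to \<open>w\<close>, which is impossible since \<open>b\<close> is strictly between \<open>a\<close> and \<open>c\<close> with respect
  to \<open>w\<close>. On the other side of the chord \<open>- u\<close> takes the place of \<open>u\<close>.\<close>

lemma voronoi_vertex_is_cell_tip: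
  assumes "voronoi_vertex P x"
  shows "\<exists>p\<in>P. \<exists>e\<in>{u, - u}. cell_tip P p e x"
proof -
  obtain a b c k where abc: "a \<in> P" "b \<in> P" "c \<in> P" "w \<bullet> b < w \<bullet> a" "w \<bullet> c < w \<bullet> b"
    "x \<in> voronoi_polygon P a" "x \<in> voronoi_polygon P b" "x \<in> voronoi_polygon P c"
    and k: "(w \<bullet> (b - c)) *\<^sub>R (b - a) + (w \<bullet> (a - b)) *\<^sub>R (b - c) = k *\<^sub>R u" "k \<noteq> 0"
    by (rule voronoi_vertex_ordered_cells[OF assms])
  have main: "0 < k * ((y - x) \<bullet> u)" if y: "y \<in> voronoi_polygon P b" "y \<noteq> x" for y
  proof -
    define d where "d = y - x"
    have d: "0 \<le> d \<bullet> (b - a)" "0 \<le> d \<bullet> (b - c)"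
      using voronoi_polygon_side[OF abc(6,7) y(1) abc(1,2)]
        voronoi_polygon_side[OF abc(8,7) y(1) abc(3,2)] by (simp_all add: d_def)
    have "k * (d \<bullet> u) = d \<bullet> (k *\<^sub>R u)" by simp
    also have "\<dots> = (w \<bullet> (b - c)) * (d \<bullet> (b - a)) + (w \<bullet> (a - b)) * (d \<bullet> (b - c))"
      unfolding k(1)[symmetric] by (simp add: inner_add_right)
    also have "\<dots> \<ge> 0" using d abc by (intro add_nonneg_nonneg mult_nonneg_nonneg)
      (auto simp: inner_diff_right)
    finally have "0 \<le> k * (d \<bullet> u)" .
    moreover have "d \<bullet> u \<noteq> 0"
    proof
      assume "d \<bullet> u = 0"
      then obtain t where t: "d = t *\<^sub>R w"
        using plane_orthogonal_parallel[OF u_nonzero w_nonzero, of d] orthogonal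
        by (auto simp: inner_commute)
      have "t \<noteq> 0" using t y by (auto simp: d_def)
      moreover have "0 \<le> t * (w \<bullet> (b - a))" "0 \<le> t * (w \<bullet> (b - c))"
        using d unfolding t by (simp_all only: inner_scaleR_left)
      moreover have "w \<bullet> (b - a) < 0" "0 < w \<bullet> (b - c)" using abc by (auto simp: inner_diff_right)
      ultimately show False by (auto simp: zero_le_mult_iff)
    qed
    ultimately show ?thesis using \<open>k \<noteq> 0\<close> unfolding d_def by (simp add: less_le)
  qed
  show ?thesis
  proof (cases "k > 0")
    case True
    then have "cell_tip P b u x" unfolding cell_tip_def
      using main abc by (auto simp: zero_less_mult_iff inner_diff inner_commute)
    with abc show ?thesis by blast
  next
    case False
    then have "cell_tip P b (- u) x" unfolding cell_tip_def
      using main abc by (auto simp: zero_less_mult_iff inner_diff inner_commute)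
    with abc show ?thesis by blast
  qed
qed

text \<open>The point \<open>r\<close> is a point of \<open>P\<close> at maximal distance from the line through \<open>p\<close> and \<open>q\<close>, on
  one side of it. The direction \<open>v\<close> is orthogonal to \<open>p - q\<close>, so it is not parallel to \<open>w\<close>.\<close>

lemma third_hull_boundary_point:
  assumes "voronoi_vertex P x" "p \<in> P" "q \<in> P" "p \<noteq> q"
  obtains r v where "r \<in> P" "r \<noteq> p" "r \<noteq> q" "u \<bullet> v \<noteq> 0" "\<And>p'. p' \<in> P \<Longrightarrow> v \<bullet> p' \<le> v \<bullet> r"
proof -
  define z where "z = p - q"
  have wz: "w \<bullet> z \<noteq> 0" using separates assms by (auto simp: z_def inner_diff_right inj_on_def)
  define v0 :: "real ^ 2" where "v0 = vector [- (z $ 2), z $ 1]"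
  have v0z: "v0 \<bullet> z = 0" by (simp add: v0_def inner_vec_def sum_2)
  have "v0 \<noteq> 0" using wz by (auto simp: v0_def vec_eq_iff forall_2 inner_vec_def sum_2)
  have uv0: "u \<bullet> v0 \<noteq> 0"
  proof
    assume "u \<bullet> v0 = 0"
    then obtain t where "v0 = t *\<^sub>R w"
      using plane_orthogonal_parallel[OF u_nonzero w_nonzero, of v0] orthogonal
      by (auto simp: inner_commute)
    then show False using v0z wz \<open>v0 \<noteq> 0\<close> by auto
  qed
  have "\<exists>r0\<in>P. v0 \<bullet> r0 \<noteq> v0 \<bullet> p"
  proof (rule ccontr)
    assume "\<not> ?thesis"
    then have const: "\<And>p'. p' \<in> P \<Longrightarrow> v0 \<bullet> p' = v0 \<bullet> p" by blast
    obtain a b c k where abc: "a \<in> P" "b \<in> P" "c \<in> P"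
      and k: "(w \<bullet> (b - c)) *\<^sub>R (b - a) + (w \<bullet> (a - b)) *\<^sub>R (b - c) = k *\<^sub>R u" "k \<noteq> 0"
      by (rule voronoi_vertex_ordered_cells[OF assms(1)])
    have "v0 \<bullet> (k *\<^sub>R u) = 0"
      unfolding k(1)[symmetric] using abc by (simp add: inner_add_right inner_diff_right const)
    then show False using k(2) uv0 by (simp add: inner_commute)
  qed
  then obtain r0 where r0: "r0 \<in> P" "v0 \<bullet> r0 \<noteq> v0 \<bullet> p" by blast
  define v where "v = (if v0 \<bullet> p < v0 \<bullet> r0 then v0 else - v0)"
  have uv: "u \<bullet> v \<noteq> 0" and vr0: "v \<bullet> p < v \<bullet> r0" and vpq: "v \<bullet> p = v \<bullet> q"
    using uv0 r0 v0z by (auto simp: v_def z_def inner_diff_right)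
  obtain r where rP: "r \<in> P" and max: "\<And>p'. p' \<in> P \<Longrightarrow> v \<bullet> p' \<le> v \<bullet> r"
    using finite_maximizer[OF finite_points r0(1), of "\<lambda>y. v \<bullet> y"] by blast
  then have "v \<bullet> p < v \<bullet> r" using vr0 r0(1) by force
  then have "r \<noteq> p" "r \<noteq> q" using vpq by auto
  then show thesis using that rP uv max by blast
qed

section \<open>Counting Voronoi vertices\<close>

lemma card_voronoi_iteration_of_vertex:
  assumes "voronoi_vertex P x"
  shows "finite (voronoi_iteration P) \<and> card (voronoi_iteration P) + 5 \<le> 2 * card P"
proof -
  obtain a c where ac: "a \<in> P" "c \<in> P" "w \<bullet> c < w \<bullet> a"
    by (rule voronoi_vertex_ordered_cells[OF assms]) (use order_less_trans in blast)
  obtain top where top: "top \<in> P" "\<And>q. q \<in> P \<Longrightarrow> w \<bullet> q \<le> w \<bullet> top"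
    using finite_maximizer[OF finite_points ac(1), of "\<lambda>y. w \<bullet> y"] by blast
  obtain bot where bot: "bot \<in> P" "\<And>q. q \<in> P \<Longrightarrow> - w \<bullet> q \<le> - w \<bullet> bot"
    using finite_maximizer[OF finite_points ac(1), of "\<lambda>y. - w \<bullet> y"] by blast
  have top_strict: "w \<bullet> q < w \<bullet> top" if "q \<in> P" "q \<noteq> top" for q
    using top that separates by (fastforce simp: inj_on_def less_le)
  have bot_strict: "- w \<bullet> q < - w \<bullet> bot" if "q \<in> P" "q \<noteq> bot" for q
    using bot that separates by (fastforce simp: inj_on_def less_le)
  have "top \<noteq> bot" using ac top(2)[of a] bot(2)[of c] by auto
  then obtain r v where r: "r \<in> P" "r \<noteq> top" "r \<noteq> bot" "u \<bullet> v \<noteq> 0"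
    "\<And>q. q \<in> P \<Longrightarrow> v \<bullet> q \<le> v \<bullet> r"
    using third_hull_boundary_point[OF assms top(1) bot(1)] by metis
  \<comment> \<open>The cell of \<open>r\<close> contains a ray along which \<open>e0\<close> is unbounded below.\<close>
  define e0 where "e0 = (if u \<bullet> v < 0 then u else - u)"
  have e0: "e0 \<in> {u, - u}" "e0 \<bullet> v < 0" using r(4) by (auto simp: e0_def)
  have dirs: "e \<noteq> 0" "e \<bullet> w = 0" "e \<bullet> - w = 0" if "e \<in> {u, - u}" for e
    using that u_nonzero orthogonal by (auto simp: inner_commute)
  define impossible where
    "impossible = {(top, u), (top, - u), (bot, u), (bot, - u), (r, e0)}"
  define events where "events = P \<times> {u, - u} - impossible"
  have "u \<noteq> - u" using u_nonzero by (simp add: eq_neg_iff_add_eq_0 flip: scaleR_2)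
  then have "card impossible = 5" "card {u, - u} = 2"
    using \<open>top \<noteq> bot\<close> r(2,3) by (auto simp: impossible_def)
  moreover have "impossible \<subseteq> P \<times> {u, - u}"
    using top(1) bot(1) r(1) e0(1) by (auto simp: impossible_def)
  ultimately have card_events: "card events = 2 * card P - 5" "5 \<le> 2 * card P"
    using finite_points card_mono[of "P \<times> {u, - u}" impossible]
    by (auto simp: events_def card_Diff_subset finite_subset card_cartesian_product)
  have "finite events" using finite_points by (simp add: events_def)
  have "\<exists>pe\<in>events. cell_tip P (fst pe) (snd pe) y" if y: "y \<in> voronoi_iteration P" for y
  proof -
    obtain p e where pe: "p \<in> P" "e \<in> {u, - u}" "cell_tip P p e y"
      using voronoi_vertex_is_cell_tip[of y] y by (auto simp: voronoi_iteration_def)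
    have "p \<noteq> top"
      using no_tip_of_strict_maximizer[OF finite_points top_strict dirs(2,1)] pe by metis
    moreover have "p \<noteq> bot"
      using no_tip_of_strict_maximizer[OF finite_points bot_strict dirs(3,1)] pe by metis
    moreover have "(p, e) \<noteq> (r, e0)"
      using no_tip_along_ray[OF r(5) e0(2)] pe by blast
    ultimately have "(p, e) \<in> events" using pe by (auto simp: events_def impossible_def)
    with pe show ?thesis by force
  qed
  then obtain f where f: "\<And>y. y \<in> voronoi_iteration P \<Longrightarrow> f y \<in> events"
    "\<And>y. y \<in> voronoi_iteration P \<Longrightarrow> cell_tip P (fst (f y)) (snd (f y)) y"
    by metis
  have inj: "inj_on f (voronoi_iteration P)"
    using f(2) cell_tip_unique by (metis inj_onI)
  have sub: "f ` voronoi_iteration P \<subseteq> events" using f(1) by blast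
  show ?thesis
    using inj_on_finite[OF inj sub \<open>finite events\<close>] card_inj_on_le[OF inj sub \<open>finite events\<close>]
      card_events by simp
qed

end

lemma card_voronoi_iteration:
  assumes "finite P"
  shows "finite (voronoi_iteration P)"
    and "int (card (voronoi_iteration P)) \<le> max 0 (2 * int (card P) - 5)"
proof -
  obtain u w where "sweep_frame P u w" using sweep_frame_exists[OF assms] .
  then interpret sweep_frame P u w .
  have "finite (voronoi_iteration P) \<and>
    int (card (voronoi_iteration P)) \<le> max 0 (2 * int (card P) - 5)"
  proof (cases "voronoi_iteration P = {}")
    case False
    then obtain x where "voronoi_vertex P x" by (auto simp: voronoi_iteration_def)
    from card_voronoi_iteration_of_vertex[OF this] show ?thesis by linarith
  qed simp
  then show "finite (voronoi_iteration P)"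
    "int (card (voronoi_iteration P)) \<le> max 0 (2 * int (card P) - 5)" by auto
qed

text \<open>The truncation at \<open>0\<close> is compatible with the recursion \<open>f \<mapsto> 2 f - 5\<close>, because that map is
  monotone and sends nonpositive values to negative ones.\<close>

theorem proposition5:
  fixes P :: "(real ^ 2) set" and n :: nat
  assumes "finite P" and "n > 0"
  shows "finite ((voronoi_iteration ^^ n) P) \<and>
         int (card ((voronoi_iteration ^^ n) P)) \<le> max 0 (2 ^ n * (int (card P) - 5) + 5)"
proof -
  have "finite ((voronoi_iteration ^^ n) P) \<and>
         int (card ((voronoi_iteration ^^ n) P)) \<le> max 0 (2 ^ n * (int (card P) - 5) + 5)" for n
  proof (induction n)
    case 0
    then show ?case using assms(1) by simp
  next
    case (Suc n)
    define Q where "Q = (voronoi_iteration ^^ n) P"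
    define b where "b = 2 ^ n * (int (card P) - 5)"
    have Q: "finite Q" "int (card Q) \<le> max 0 (b + 5)" using Suc by (simp_all add: Q_def b_def)
    have "int (card (voronoi_iteration Q)) \<le> max 0 (2 * b + 5)"
      using card_voronoi_iteration(2)[OF Q(1)] Q(2) by linarith
    then show ?case
      using card_voronoi_iteration(1)[OF Q(1)] by (simp add: Q_def b_def)
  qed
  then show ?thesis .
qed

end
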